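(* Let $K$ be a field, let $E$ be a finite directed graph and let $H$ be a hereditary saturated subset of $E^0$. If $L_K(E/H)$ has gr-IBN, then $L_K(E)$ has gr-IBN.
   Context: A directed graph $E=(E^0,E^1,s,r)$ consists of disjoint sets $E^0$ (vertices) and $E^1$ (edges) with maps $s,r:E^1\to E^0$ (source, range). It is finite if $E^0$ and $E^1$ are finite. A vertex $v$ is regular if $0<|s^{-1}(v)|<\infty$. A subset $H\subseteq E^0$ is hereditary if $r(e)\in H$ for all $v\in H$ and $e\in s^{-1}(v)$; it is saturated if for every regular vertex $v$, $r(s^{-1}(v))\subseteq H$ implies $v\in H$. For $H$ hereditary and saturated, the quotient graph $E/H$ has $(E/H)^0=E^0\setminus H$, $(E/H)^1=\{e\in E^1: r(e)\notin H\}$, with source and range maps restricted from $E$. The Leavitt path algebra $L_K(E)$ is the $K$-algebra generated by $E^0\cup E^1\cup\{e^*\mid e\in E^1\}$ subject to, for all $v,w\in E^0$ and $e,f\in E^1$: (1) $vw=\delta_{v,w}w$; (2) $s(e)e=e=er(e)$ and $r(e)e^*=e^*=e^*s(e)$; (3) $e^*f=\delta_{e,f}r(e)$; (4) $v=\sum_{e\in s^{-1}(v)}ee^*$ for every regular vertex $v$. It is $\mathbb{Z}$-graded with $\deg v=0$, $\deg e=1$, $\deg e^*=-1$. For an abelian group $\Gamma$, a $\Gamma$-graded ring $R$ and $\delta\in\Gamma$, the shifted graded right module $R(\delta)$ has components $R(\delta)_\gamma=R_{\delta+\gamma}$; $\cong_{gr}$ denotes isomorphism of right modules preserving degrees. $R$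 has gr-IBN (Graded Invariant Basis Number) if for all positive integers $m,n$ and all $\alpha_1,\dots,\alpha_m,\beta_1,\dots,\beta_n\in\Gamma$, $R(\alpha_1)\oplus\cdots\oplus R(\alpha_m)\cong_{gr}R(\beta_1)\oplus\cdots\oplus R(\beta_n)$ as graded right $R$-modules implies $m=n$. *)

theory Defs
  imports
    "HOL-Algebra.QuotRing"
    "HOL-Library.Poly_Mapping"
    "HOL-Library.FuncSet"
    "Graph_Theory.Digraph"
begin

section \<open>Graded rings, graded right modules and gr-IBN\<close>

record ('a, 'g) graded = "'a ring" +
  component :: "'g \<Rightarrow> 'a set"

text \<open>As for modules in HOL-Algebra, the fields \<open>mult\<close> and \<open>one\<close> inherited from rings are
  not used for right modules.\<close>

record ('r, 'm, 'g) graded_rmodule = "('m, 'g) graded" +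
  rsmult :: "'m \<Rightarrow> 'r \<Rightarrow> 'm"

definition shift :: "('a, 'g::ab_group_add) graded \<Rightarrow> 'g \<Rightarrow> ('a, 'a, 'g) graded_rmodule" where
  "shift R \<delta> =
     \<lparr>carrier = carrier R, mult = undefined, one = undefined, zero = zero R, add = add R,
      component = (\<lambda>\<gamma>. component R (\<delta> + \<gamma>)), rsmult = mult R\<rparr>"

text \<open>The direct product of a family; it is the direct sum since it is only used for finite
  index sets.\<close>

definition direct_sum ::
    "'i set \<Rightarrow> ('i \<Rightarrow> ('r, 'm, 'g) graded_rmodule) \<Rightarrow> ('r, 'i \<Rightarrow> 'm, 'g) graded_rmodule" where
  "direct_sum I M =
     \<lparr>carrier = (\<Pi>\<^sub>E i\<in>I. carrier (M i)), mult = undefined, one = undefined,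
      zero = (\<lambda>i\<in>I. \<zero>\<^bsub>M i\<^esub>), add = (\<lambda>x y. \<lambda>i\<in>I. x i \<oplus>\<^bsub>M i\<^esub> y i),
      component = (\<lambda>\<gamma>. \<Pi>\<^sub>E i\<in>I. component (M i) \<gamma>),
      rsmult = (\<lambda>x r. \<lambda>i\<in>I. rsmult (M i) (x i) r)\<rparr>"

definition graded_isomorphic ::
    "('r, 'g) graded \<Rightarrow> ('r, 'm, 'g) graded_rmodule \<Rightarrow> ('r, 'n, 'g) graded_rmodule \<Rightarrow> bool" where
  "graded_isomorphic R M N \<longleftrightarrow>
     (\<exists>f \<in> iso (add_monoid M) (add_monoid N).
        (\<forall>x \<in> carrier M. \<forall>r \<in> carrier R. f (rsmult M x r) = rsmult N (f x) r) \<and>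
        (\<forall>\<gamma>. \<forall>x \<in> component M \<gamma>. f x \<in> component N \<gamma>))"

definition gr_IBN :: "('a, 'g::ab_group_add) graded \<Rightarrow> bool" where
  "gr_IBN R \<longleftrightarrow>
     (\<forall>m n (\<alpha> :: nat \<Rightarrow> 'g) (\<beta> :: nat \<Rightarrow> 'g).
        m > 0 \<longrightarrow> n > 0 \<longrightarrow>
        graded_isomorphic R
          (direct_sum {..<m} (\<lambda>i. shift R (\<alpha> i))) (direct_sum {..<n} (\<lambda>j. shift R (\<beta> j))) \<longrightarrow>
        m = n)"


section \<open>Directed graphs\<close>

text \<open>Graphs are those of the theory Digraph, with \<open>tail\<close> as source and \<open>head\<close> as range map;
  loops and parallel edges are allowed.\<close>

definition regular_vertex :: "('v, 'e) pre_digraph \<Rightarrow> 'v \<Rightarrow> bool" where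
  "regular_vertex E v \<longleftrightarrow> v \<in> verts E \<and> out_arcs E v \<noteq> {} \<and> finite (out_arcs E v)"

definition hereditary :: "('v, 'e) pre_digraph \<Rightarrow> 'v set \<Rightarrow> bool" where
  "hereditary E H \<longleftrightarrow> H \<subseteq> verts E \<and> (\<forall>v \<in> H. \<forall>e \<in> out_arcs E v. head E e \<in> H)"

definition saturated :: "('v, 'e) pre_digraph \<Rightarrow> 'v set \<Rightarrow> bool" where
  "saturated E H \<longleftrightarrow>
     H \<subseteq> verts E \<and> (\<forall>v. regular_vertex E v \<longrightarrow> head E ` out_arcs E v \<subseteq> H \<longrightarrow> v \<in> H)"

definition quotient_graph :: "('v, 'e) pre_digraph \<Rightarrow> 'v set \<Rightarrow> ('v, 'e) pre_digraph" where
  "quotient_graph E H =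
     \<lparr>verts = verts E - H, arcs = {e \<in> arcs E. head E e \<notin> H}, tail = tail E, head = head E\<rparr>"


section \<open>Free algebras\<close>

text \<open>The free monoid, written additively, so that \<open>'x word \<Rightarrow>\<^sub>0 'k\<close> with the convolution product
  of \<^theory>\<open>HOL-Library.Poly_Mapping\<close> is the free unital associative algebra on \<open>'x\<close>.\<close>

datatype 'x word = Word (letters: "'x list")

instantiation word :: (type) monoid_add
begin

definition "0 = Word []"
definition "u + v = Word (letters u @ letters v)"

instance
  by standard (simp_all add: zero_word_def plus_word_def)

end

definition free_algebra :: "'x set \<Rightarrow> ('x word \<Rightarrow>\<^sub>0 'k::field) ring" where
  "free_algebra X =
     \<lparr>carrier = {p. \<forall>w \<in> Poly_Mapping.keys p. set (letters w) \<subseteq> X},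
      mult = (*), one = 1, zero = 0, add = (+)\<rparr>"

definition nonunital_free_algebra :: "'x set \<Rightarrow> ('x word \<Rightarrow>\<^sub>0 'k::field) set" where
  "nonunital_free_algebra X = {p \<in> carrier (free_algebra X). 0 \<notin> Poly_Mapping.keys p}"

definition monomial :: "'x \<Rightarrow> 'x word \<Rightarrow>\<^sub>0 'k::field" where
  "monomial x = Poly_Mapping.single (Word [x]) 1"


section \<open>Leavitt path algebras\<close>

datatype ('v, 'e) generator = Vertex 'v | Edge 'e | Ghost 'e

fun generator_degree :: "('v, 'e) generator \<Rightarrow> int" where
  "generator_degree (Vertex v) = 0"
| "generator_degree (Edge e) = 1"
| "generator_degree (Ghost e) = -1"

definition word_degree :: "('v, 'e) generator word \<Rightarrow> int" where
  "word_degree w = (\<Sum>x\<leftarrow>letters w. generator_degree x)"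

definition generators :: "('v, 'e) pre_digraph \<Rightarrow> ('v, 'e) generator set" where
  "generators E = Vertex ` verts E \<union> Edge ` arcs E \<union> Ghost ` arcs E"

abbreviation vtx :: "'v \<Rightarrow> ('v, 'e) generator word \<Rightarrow>\<^sub>0 'k::field" where
  "vtx v \<equiv> monomial (Vertex v)"

abbreviation edg :: "'e \<Rightarrow> ('v, 'e) generator word \<Rightarrow>\<^sub>0 'k::field" where
  "edg e \<equiv> monomial (Edge e)"

abbreviation gho :: "'e \<Rightarrow> ('v, 'e) generator word \<Rightarrow>\<^sub>0 'k::field" where
  "gho e \<equiv> monomial (Ghost e)"

definition leavitt_relators ::
    "('v, 'e) pre_digraph \<Rightarrow> (('v, 'e) generator word \<Rightarrow>\<^sub>0 'k::field) set" where
  "leavitt_relators E =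
     {vtx v * vtx w - (if v = w then vtx w else 0) | v w. v \<in> verts E \<and> w \<in> verts E}
   \<union> {vtx (tail E e) * edg e - edg e | e. e \<in> arcs E}
   \<union> {edg e * vtx (head E e) - edg e | e. e \<in> arcs E}
   \<union> {vtx (head E e) * gho e - gho e | e. e \<in> arcs E}
   \<union> {gho e * vtx (tail E e) - gho e | e. e \<in> arcs E}
   \<union> {gho e * edg f - (if e = f then vtx (head E e) else 0) | e f. e \<in> arcs E \<and> f \<in> arcs E}
   \<union> {vtx v - (\<Sum>e \<in> out_arcs E v. edg e * gho e) | v. regular_vertex E v}"

text \<open>The free unital algebra contains the scalars, so its ring ideals are algebra ideals.
  Moreover the ideal it generates from the relators, which have no constant term, is also the
  ideal they generate in the nonunital free algebra.\<close>

definition leavitt_ideal ::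
    "('v, 'e) pre_digraph \<Rightarrow> (('v, 'e) generator word \<Rightarrow>\<^sub>0 'k::field) set" where
  "leavitt_ideal E = genideal (free_algebra (generators E)) (leavitt_relators E)"

definition leavitt_class ::
    "('v, 'e) pre_digraph \<Rightarrow> (('v, 'e) generator word \<Rightarrow>\<^sub>0 'k::field)
       \<Rightarrow> (('v, 'e) generator word \<Rightarrow>\<^sub>0 'k) set" where
  "leavitt_class E p = leavitt_ideal E +>\<^bsub>free_algebra (generators E)\<^esub> p"

text \<open>The Leavitt path algebra is presented by generators and relations among algebras that need
  not be unital; it is therefore the quotient of the nonunital free algebra, and for finite \<open>E\<close>
  its unit is the sum of the vertices (it is the zero ring if \<open>E\<close> has no vertices).\<close>

definition leavitt_path_algebra ::
    "'k::field itself \<Rightarrow> ('v, 'e) pre_digraph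
       \<Rightarrow> ((('v, 'e) generator word \<Rightarrow>\<^sub>0 'k) set, int) graded" where
  "leavitt_path_algebra K E =
     (let A = nonunital_free_algebra (generators E);
          Q = free_algebra (generators E) Quot leavitt_ideal E
      in \<lparr>carrier = leavitt_class E ` A, mult = mult Q,
          one = leavitt_class E (\<Sum>v \<in> verts E. vtx v), zero = zero Q, add = add Q,
          component =
            (\<lambda>n. leavitt_class E ` {p \<in> A. \<forall>w \<in> Poly_Mapping.keys p. word_degree w = n})\<rparr>)"

end

theory Submission
  imports Defs "HOL-Algebra.UnivPoly"
begin

text \<open>
  The invariant basis number is inherited backwards along ring homomorphisms that preserve the
  unit, and so is its graded version along homomorphisms that also preserve degrees
  (\<open>gr_IBN_of_graded_hom\<close>). A homomorphism of right modules between \<open>R(\<alpha>\<^sub>1) \<oplus> \<dots> \<oplus> R(\<alpha>\<^sub>m)\<close> and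
  \<open>R(\<beta>\<^sub>1) \<oplus> \<dots> \<oplus> R(\<beta>\<^sub>n)\<close> is left multiplication by an \<open>n \<times> m\<close> matrix, and it preserves degrees
  exactly if the entry in row \<open>j\<close> and column \<open>i\<close> is homogeneous of degree \<open>\<beta>\<^sub>j - \<alpha>\<^sub>i\<close>. An isomorphism is
  given by a matrix that has an inverse. Applying a graded homomorphism \<open>R \<rightarrow> S\<close> to all entries of both
  matrices yields mutually inverse matrices over \<open>S\<close>, and the degrees of the entries are kept. Hence
  there is a graded isomorphism over \<open>S\<close> between sums of the same numbers of shifts.

  It remains to find a graded unital homomorphism from \<open>L(E)\<close> to \<open>L(E/H)\<close>
  (\<open>leavitt_quotient_map_graded_hom\<close>). It is the one that kills the vertices in \<open>H\<close> and the edges and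
  ghost edges whose range lies in \<open>H\<close>, and fixes all other generators. On free algebras this is the
  truncation of a polynomial to the words in the remaining letters, and the point is that it
  sends every defining relation of \<open>L(E)\<close> to a defining relation of \<open>L(E/H)\<close> or to zero
  (\<open>restrict_letters_relator\<close>), which uses that \<open>H\<close> is hereditary and saturated.

  Units need some care: the Leavitt path algebra is a quotient of an algebra without unit, and its
  unit is the class of the sum of all vertices (\<open>vertex_sum_unit\<close>). The truncation sends the sum of
  the vertices of \<open>E\<close> to that of the vertices of \<open>E/H\<close>, so the homomorphism is unital.
\<close>

section \<open>Linear maps between finite free right modules\<close>

abbreviation tuples :: "('a, 'b) ring_scheme \<Rightarrow> 'i set \<Rightarrow> ('i \<Rightarrow> 'a) set" where
  "tuples R I \<equiv> (\<Pi>\<^sub>E i\<in>I. carrier R)"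

definition unit_tuple :: "('a, 'b) ring_scheme \<Rightarrow> 'i set \<Rightarrow> 'i \<Rightarrow> 'i \<Rightarrow> 'a" where
  "unit_tuple R I k = (\<lambda>i\<in>I. if k = i then \<one>\<^bsub>R\<^esub> else \<zero>\<^bsub>R\<^esub>)"

definition matrix_map ::
    "('a, 'b) ring_scheme \<Rightarrow> 'i set \<Rightarrow> 'j set \<Rightarrow> ('j \<Rightarrow> 'i \<Rightarrow> 'a) \<Rightarrow> ('i \<Rightarrow> 'a) \<Rightarrow> 'j \<Rightarrow> 'a" where
  "matrix_map R I J A x = (\<lambda>j\<in>J. \<Oplus>\<^bsub>R\<^esub>i\<in>I. A j i \<otimes>\<^bsub>R\<^esub> x i)"

definition right_linear ::
    "('a, 'b) ring_scheme \<Rightarrow> 'i set \<Rightarrow> 'j set \<Rightarrow> (('i \<Rightarrow> 'a) \<Rightarrow> 'j \<Rightarrow> 'a) \<Rightarrow> bool" where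
  "right_linear R I J f \<longleftrightarrow>
     f \<in> tuples R I \<rightarrow> tuples R J \<and>
     (\<forall>x \<in> tuples R I. \<forall>y \<in> tuples R I.
        f (\<lambda>i\<in>I. x i \<oplus>\<^bsub>R\<^esub> y i) = (\<lambda>j\<in>J. f x j \<oplus>\<^bsub>R\<^esub> f y j)) \<and>
     (\<forall>x \<in> tuples R I. \<forall>r \<in> carrier R.
        f (\<lambda>i\<in>I. x i \<otimes>\<^bsub>R\<^esub> r) = (\<lambda>j\<in>J. f x j \<otimes>\<^bsub>R\<^esub> r))"

definition left_inverse_matrix ::
    "('a, 'b) ring_scheme \<Rightarrow> 'i set \<Rightarrow> 'j set \<Rightarrow> ('i \<Rightarrow> 'j \<Rightarrow> 'a) \<Rightarrow> ('j \<Rightarrow> 'i \<Rightarrow> 'a) \<Rightarrow> bool" where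
  "left_inverse_matrix R I J B A \<longleftrightarrow>
     (\<forall>i \<in> I. \<forall>k \<in> I.
        (\<Oplus>\<^bsub>R\<^esub>j\<in>J. B i j \<otimes>\<^bsub>R\<^esub> A j k) = (if k = i then \<one>\<^bsub>R\<^esub> else \<zero>\<^bsub>R\<^esub>))"

lemma right_linearD:
  assumes "right_linear R I J f"
  shows "x \<in> tuples R I \<Longrightarrow> f x \<in> tuples R J"
    and "x \<in> tuples R I \<Longrightarrow> y \<in> tuples R I \<Longrightarrow>
      f (\<lambda>i\<in>I. x i \<oplus>\<^bsub>R\<^esub> y i) = (\<lambda>j\<in>J. f x j \<oplus>\<^bsub>R\<^esub> f y j)"
    and "x \<in> tuples R I \<Longrightarrow> r \<in> carrier R \<Longrightarrow>
      f (\<lambda>i\<in>I. x i \<otimes>\<^bsub>R\<^esub> r) = (\<lambda>j\<in>J. f x j \<otimes>\<^bsub>R\<^esub> r)"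
  using assms unfolding right_linear_def by blast+

lemma right_linear_compose:
  assumes f: "right_linear R I J f" and g: "right_linear R J L g"
  shows "right_linear R I L (\<lambda>x. g (f x))"
  unfolding right_linear_def
  using right_linearD[OF f] right_linearD[OF g] by (simp add: Pi_iff)

context ring
begin

lemma unit_tuple_closed: "unit_tuple R I k \<in> tuples R I"
  by (auto simp: unit_tuple_def)

lemma right_linear_inverse:
  assumes f: "right_linear R I J f" and bij: "bij_betw f (tuples R I) (tuples R J)"
  shows "right_linear R J I (inv_into (tuples R I) f)" (is "right_linear R J I ?g")
proof -
  have img: "f ` tuples R I = tuples R J"
    using bij by (rule bij_betw_imp_surj_on)
  have g: "?g y \<in> tuples R I" "f (?g y) = y" if "y \<in> tuples R J" for y
    using that img inv_into_into[of y f "tuples R I"] f_inv_into_f[of y f "tuples R I"] by simp_all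
  have gf: "?g (f x) = x" if "x \<in> tuples R I" for x
    using bij that by (rule bij_betw_inv_into_left)
  show ?thesis
    unfolding right_linear_def
  proof (intro conjI ballI)
    show "?g \<in> tuples R J \<rightarrow> tuples R I"
      using g(1) by blast
  next
    fix x y assume x: "x \<in> tuples R J" and y: "y \<in> tuples R J"
    let ?s = "\<lambda>i\<in>I. ?g x i \<oplus> ?g y i"
    have s: "?s \<in> tuples R I"
      using g(1)[OF x] g(1)[OF y] by (auto simp: PiE_iff)
    have "f ?s = (\<lambda>j\<in>J. x j \<oplus> y j)"
      using right_linearD(2)[OF f g(1)[OF x] g(1)[OF y]] g(2)[OF x] g(2)[OF y] by simp
    then show "?g (\<lambda>j\<in>J. x j \<oplus> y j) = ?s"
      using gf[OF s] by simp
  next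
    fix x r assume x: "x \<in> tuples R J" and r: "r \<in> carrier R"
    let ?s = "\<lambda>i\<in>I. ?g x i \<otimes> r"
    have s: "?s \<in> tuples R I"
      using g(1)[OF x] r by (auto simp: PiE_iff)
    have "f ?s = (\<lambda>j\<in>J. x j \<otimes> r)"
      using right_linearD(3)[OF f g(1)[OF x] r] g(2)[OF x] by simp
    then show "?g (\<lambda>j\<in>J. x j \<otimes> r) = ?s"
      using gf[OF s] by simp
  qed
qed

text \<open>A tuple is the sum of the unit tuples multiplied from the right by its entries. The proof adds
  the entries one at a time, so that additivity is only ever applied to two tuples.\<close>

lemma right_linear_eq_matrix_map:
  assumes "finite I" and f: "right_linear R I J f" and x: "x \<in> tuples R I"
  shows "f x = matrix_map R I J (\<lambda>j i. f (unit_tuple R I i) j) x"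
proof -
  define part where "part F = (\<lambda>i\<in>I. if i \<in> F then x i else \<zero>)" for F
  have part: "part F \<in> tuples R I" for F
    using x by (auto simp: part_def)
  have xi: "x i \<in> carrier R" if "i \<in> I" for i
    using x that by auto
  have fe: "f (unit_tuple R I i) j \<in> carrier R" if "j \<in> J" for i j
    using right_linearD(1)[OF f unit_tuple_closed] that by auto
  have sum: "\<forall>j\<in>J. f (part F) j = (\<Oplus>i\<in>F. f (unit_tuple R I i) j \<otimes> x i)" if "finite F" "F \<subseteq> I" for F
    using that
  proof (induction F rule: finite_induct)
    case empty
    have "part {} = (\<lambda>i\<in>I. part {} i \<otimes> \<zero>)"
      by (auto simp: part_def)
    then have "f (part {}) = (\<lambda>j\<in>J. f (part {}) j \<otimes> \<zero>)"
      using right_linearD(3)[OF f part, of \<zero> "{}"] by simp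
    then have "f (part {}) j = f (part {}) j \<otimes> \<zero>" if "j \<in> J" for j
      using that by (metis restrict_apply')
    then show ?case
      using right_linearD(1)[OF f part] by (simp add: PiE_iff)
  next
    case (insert k F)
    have k: "k \<in> I" and F: "F \<subseteq> I" using insert.prems by auto
    let ?e = "\<lambda>i\<in>I. unit_tuple R I k i \<otimes> x k"
    have e: "?e \<in> tuples R I"
      using unit_tuple_closed[of I k] xi[OF k] by (auto simp: PiE_iff)
    have "part (insert k F) = (\<lambda>i\<in>I. ?e i \<oplus> part F i)"
      using insert.hyps xi xi[OF k] by (auto simp: part_def unit_tuple_def fun_eq_iff)
    then have "f (part (insert k F)) = (\<lambda>j\<in>J. f ?e j \<oplus> f (part F) j)"
      using right_linearD(2)[OF f e part] by simp
    also have "f ?e = (\<lambda>j\<in>J. f (unit_tuple R I k) j \<otimes> x k)"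
      by (rule right_linearD(3)[OF f unit_tuple_closed xi[OF k]])
    finally have "f (part (insert k F)) j = f (unit_tuple R I k) j \<otimes> x k \<oplus> f (part F) j"
      if "j \<in> J" for j using that by simp
    moreover have "(\<Oplus>i\<in>insert k F. f (unit_tuple R I i) j \<otimes> x i)
        = f (unit_tuple R I k) j \<otimes> x k \<oplus> (\<Oplus>i\<in>F. f (unit_tuple R I i) j \<otimes> x i)"
      if "j \<in> J" for j
      using insert.hyps k F fe[OF that] xi by (intro finsum_insert) auto
    ultimately show ?case
      using insert.IH[OF F] by simp
  qed
  have "part I = x"
    using x by (auto simp: part_def fun_eq_iff PiE_iff extensional_def)
  moreover have "f x \<in> extensional J"
    using right_linearD(1)[OF f x] by (simp add: PiE_iff)
  ultimately show ?thesis
    using sum[OF \<open>finite I\<close> subset_refl]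
    by (intro ext) (simp add: matrix_map_def extensional_def)
qed

lemma right_linear_matrix_map:
  assumes A: "\<And>j i. j \<in> J \<Longrightarrow> i \<in> I \<Longrightarrow> A j i \<in> carrier R"
  shows "right_linear R I J (matrix_map R I J A)"
proof -
  have closed: "(\<lambda>i. A j i \<otimes> x i) \<in> I \<rightarrow> carrier R" if "j \<in> J" "x \<in> tuples R I" for j x
    using that A by (auto simp: PiE_iff)
  have add: "(\<Oplus>i\<in>I. A j i \<otimes> (\<lambda>i\<in>I. x i \<oplus> y i) i)
      = (\<Oplus>i\<in>I. A j i \<otimes> x i) \<oplus> (\<Oplus>i\<in>I. A j i \<otimes> y i)"
    if "j \<in> J" "x \<in> tuples R I" "y \<in> tuples R I" for j x y
  proof -
    have "(\<Oplus>i\<in>I. A j i \<otimes> (\<lambda>i\<in>I. x i \<oplus> y i) i) = (\<Oplus>i\<in>I. A j i \<otimes> x i \<oplus> A j i \<otimes> y i)"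
      using that A by (intro finsum_cong') (auto simp: PiE_iff r_distr)
    then show ?thesis
      using finsum_addf[OF closed[OF that(1,2)] closed[OF that(1,3)]] by simp
  qed
  have scale: "(\<Oplus>i\<in>I. A j i \<otimes> (\<lambda>i\<in>I. x i \<otimes> r) i) = (\<Oplus>i\<in>I. A j i \<otimes> x i) \<otimes> r"
    if "j \<in> J" "x \<in> tuples R I" "r \<in> carrier R" for j x r
  proof -
    have "(\<Oplus>i\<in>I. A j i \<otimes> (\<lambda>i\<in>I. x i \<otimes> r) i) = (\<Oplus>i\<in>I. A j i \<otimes> x i \<otimes> r)"
      using that A by (intro finsum_cong') (auto simp: PiE_iff m_assoc)
    also have "\<dots> = (\<Oplus>i\<in>I. A j i \<otimes> x i) \<otimes> r"
      using that closed[OF that(1,2)]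
      by (cases "finite I") (simp_all add: finsum_ldistr finsum_infinite)
    finally show ?thesis .
  qed
  show ?thesis
    unfolding right_linear_def matrix_map_def using closed add scale
    by (auto intro!: finsum_closed)
qed

lemma matrix_map_unit_tuple:
  assumes "finite I" "k \<in> I" and A: "\<And>j i. j \<in> J \<Longrightarrow> i \<in> I \<Longrightarrow> A j i \<in> carrier R"
  shows "matrix_map R I J A (unit_tuple R I k) = (\<lambda>j\<in>J. A j k)"
proof -
  have "(\<Oplus>i\<in>I. A j i \<otimes> unit_tuple R I k i) = A j k" if "j \<in> J" for j
  proof -
    have "(\<Oplus>i\<in>I. A j i \<otimes> unit_tuple R I k i) = (\<Oplus>i\<in>I. if k = i then A j i else \<zero>)"
      using A that by (intro finsum_cong') (auto simp: unit_tuple_def)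
    also have "\<dots> = A j k"
      using A that assms(1,2) by (intro finsum_singleton) auto
    finally show ?thesis .
  qed
  then show ?thesis
    by (auto simp: matrix_map_def)
qed

text \<open>The composite fixes every unit tuple, and the value of the outer map at a column of the inner
  matrix is, by linearity, an entry of the product matrix.\<close>

lemma left_inverse_matrix_of_right_linear:
  assumes fin: "finite I" "finite J"
    and f: "right_linear R I J f" and g: "right_linear R J I g"
    and gf: "\<And>x. x \<in> tuples R I \<Longrightarrow> g (f x) = x"
  shows "left_inverse_matrix R I J (\<lambda>i j. g (unit_tuple R J j) i) (\<lambda>j i. f (unit_tuple R I i) j)"
  unfolding left_inverse_matrix_def
proof (intro ballI)
  fix i k assume i: "i \<in> I" and k: "k \<in> I"
  let ?c = "f (unit_tuple R I k)"
  have "(\<Oplus>j\<in>J. g (unit_tuple R J j) i \<otimes> ?c j) = g ?c i"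
    using right_linear_eq_matrix_map[OF fin(2) g right_linearD(1)[OF f unit_tuple_closed]] i
    by (simp add: matrix_map_def)
  also have "\<dots> = (if k = i then \<one> else \<zero>)"
    using gf[OF unit_tuple_closed] i by (simp add: unit_tuple_def)
  finally show "(\<Oplus>j\<in>J. g (unit_tuple R J j) i \<otimes> ?c j) = (if k = i then \<one> else \<zero>)" .
qed

text \<open>Both the composite and the identity are linear, hence determined by the unit tuples, on which
  they agree. This avoids interchanging two sums.\<close>

lemma matrix_map_left_inverse:
  assumes fin: "finite I" "finite J"
    and A: "\<And>j i. j \<in> J \<Longrightarrow> i \<in> I \<Longrightarrow> A j i \<in> carrier R"
    and B: "\<And>i j. i \<in> I \<Longrightarrow> j \<in> J \<Longrightarrow> B i j \<in> carrier R"
    and inv: "left_inverse_matrix R I J B A" and x: "x \<in> tuples R I"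
  shows "matrix_map R J I B (matrix_map R I J A x) = x"
proof -
  let ?h = "\<lambda>x. matrix_map R J I B (matrix_map R I J A x)"
  have lin: "right_linear R I I ?h" and lin_id: "right_linear R I I (\<lambda>x. x)"
    using right_linear_compose[OF right_linear_matrix_map right_linear_matrix_map] A B
    by (blast, simp add: right_linear_def)
  have h: "?h (unit_tuple R I k) = unit_tuple R I k" if k: "k \<in> I" for k
  proof -
    have "matrix_map R J I B (\<lambda>j\<in>J. A j k) = (\<lambda>i\<in>I. \<Oplus>j\<in>J. B i j \<otimes> A j k)"
      unfolding matrix_map_def using A B k
      by (intro restrict_ext finsum_cong') auto
    also have "\<dots> = unit_tuple R I k"
      using inv k by (auto simp: left_inverse_matrix_def unit_tuple_def)
    finally show ?thesis
      using matrix_map_unit_tuple[OF fin(1) k, of J A] A by simp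
  qed
  have "?h x = matrix_map R I I (\<lambda>i k. ?h (unit_tuple R I k) i) x"
    by (rule right_linear_eq_matrix_map[OF fin(1) lin x])
  also have "\<dots> = matrix_map R I I (\<lambda>i k. unit_tuple R I k i) x"
    unfolding matrix_map_def[of R I I] using x h
    by (intro restrict_ext finsum_cong') (auto simp: unit_tuple_def PiE_iff)
  also have "\<dots> = x"
    by (rule right_linear_eq_matrix_map[OF fin(1) lin_id x, symmetric])
  finally show ?thesis .
qed

end

text \<open>This is the reason for passing from module isomorphisms to matrices: a ring homomorphism cannot
  be applied to a linear map, but it can be applied to the entries of a matrix, and it preserves
  the polynomial identities saying that two matrices are inverse to each other.\<close>

lemma (in ring_hom_ring) left_inverse_matrix_hom:
  assumes "\<And>j i. j \<in> J \<Longrightarrow> i \<in> I \<Longrightarrow> A j i \<in> carrier R"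
    and "\<And>i j. i \<in> I \<Longrightarrow> j \<in> J \<Longrightarrow> B i j \<in> carrier R"
    and inv: "left_inverse_matrix R I J B A"
  shows "left_inverse_matrix S I J (\<lambda>i j. h (B i j)) (\<lambda>j i. h (A j i))"
  unfolding left_inverse_matrix_def
proof (intro ballI)
  fix i k assume i: "i \<in> I" and k: "k \<in> I"
  have closed: "(\<lambda>j. B i j \<otimes> A j k) \<in> J \<rightarrow> carrier R"
    using assms(1,2) i k by auto
  have "(\<Oplus>\<^bsub>S\<^esub>j\<in>J. h (B i j) \<otimes>\<^bsub>S\<^esub> h (A j k)) = (\<Oplus>\<^bsub>S\<^esub>j\<in>J. (h \<circ> (\<lambda>j. B i j \<otimes> A j k)) j)"
    using assms(1,2) i k by (intro S.finsum_cong') auto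
  also have "\<dots> = h (\<Oplus>j\<in>J. B i j \<otimes> A j k)"
    using hom_finsum[OF closed] by (simp add: comp_def)
  also have "\<dots> = (if k = i then \<one>\<^bsub>S\<^esub> else \<zero>\<^bsub>S\<^esub>)"
    using inv i k by (simp add: left_inverse_matrix_def)
  finally show "(\<Oplus>\<^bsub>S\<^esub>j\<in>J. h (B i j) \<otimes>\<^bsub>S\<^esub> h (A j k)) = (if k = i then \<one>\<^bsub>S\<^esub> else \<zero>\<^bsub>S\<^esub>)" .
qed

section \<open>Transport of gr-IBN along graded homomorphisms\<close>

text \<open>Compatibility of the degrees with the ring operations, which is what lets a matrix with
  homogeneous entries act on shifted modules. The adverb is there because distinct components may
  overlap and need not span the ring.\<close>

locale weakly_graded_ring = ring R for R :: "('a, 'g::ab_group_add) graded" (structure) +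
  assumes component_closed: "a \<in> component R \<gamma> \<Longrightarrow> a \<in> carrier R"
    and component_zero: "\<zero> \<in> component R \<gamma>"
    and component_add: "a \<in> component R \<gamma> \<Longrightarrow> b \<in> component R \<gamma> \<Longrightarrow> a \<oplus> b \<in> component R \<gamma>"
    and component_one: "\<one> \<in> component R 0"
    and component_mult: "a \<in> component R \<gamma> \<Longrightarrow> b \<in> component R \<delta> \<Longrightarrow> a \<otimes> b \<in> component R (\<gamma> + \<delta>)"
begin

lemma component_finsum:
  assumes "\<And>i. i \<in> I \<Longrightarrow> a i \<in> component R \<gamma>"
  shows "(\<Oplus>i\<in>I. a i) \<in> component R \<gamma>"
  using assms
proof (induction I rule: infinite_finite_induct)
  case (insert k I)
  then have "a k \<in> component R \<gamma>" "(\<Oplus>i\<in>I. a i) \<in> component R \<gamma>" by auto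
  then show ?case
    using insert by (subst finsum_insert) (auto intro: component_add component_closed)
qed (simp_all add: component_zero finsum_infinite)

lemma shift_sum_simps:
  "carrier (direct_sum I (\<lambda>i. shift R (\<alpha> i))) = tuples R I"
  "add (direct_sum I (\<lambda>i. shift R (\<alpha> i))) = (\<lambda>x y. \<lambda>i\<in>I. x i \<oplus> y i)"
  "rsmult (direct_sum I (\<lambda>i. shift R (\<alpha> i))) = (\<lambda>x r. \<lambda>i\<in>I. x i \<otimes> r)"
  "component (direct_sum I (\<lambda>i. shift R (\<alpha> i))) \<gamma> = (\<Pi>\<^sub>E i\<in>I. component R (\<alpha> i + \<gamma>))"
  by (simp_all add: direct_sum_def shift_def)

text \<open>All shifts have the same underlying module, so a graded isomorphism is a bijective linear map
  between ordinary modules of tuples together with a condition on degrees.\<close>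

lemma graded_isomorphic_shift_sums_iff:
  "graded_isomorphic R (direct_sum I (\<lambda>i. shift R (\<alpha> i))) (direct_sum J (\<lambda>j. shift R (\<beta> j))) \<longleftrightarrow>
     (\<exists>f. right_linear R I J f \<and> bij_betw f (tuples R I) (tuples R J) \<and>
        (\<forall>\<gamma>. \<forall>x \<in> \<Pi>\<^sub>E i\<in>I. component R (\<alpha> i + \<gamma>). f x \<in> (\<Pi>\<^sub>E j\<in>J. component R (\<beta> j + \<gamma>))))"
  unfolding graded_isomorphic_def iso_def hom_def right_linear_def Bex_def
  by (simp add: shift_sum_simps bij_betw_def) blast

text \<open>In the sum of the shifts by \<open>\<alpha>\<close>, the \<open>i\<close>-th unit tuple is homogeneous of degree \<open>- \<alpha> i\<close>, so
  the \<open>j\<close>-th entry of its image lies in the component \<open>\<beta> j - \<alpha> i\<close> of the ring.\<close>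

lemma homogeneous_matrices_of_graded_isomorphic:
  assumes fin: "finite I" "finite J"
    and iso: "graded_isomorphic R
      (direct_sum I (\<lambda>i. shift R (\<alpha> i))) (direct_sum J (\<lambda>j. shift R (\<beta> j)))"
  obtains A B where
    "\<And>j i. j \<in> J \<Longrightarrow> i \<in> I \<Longrightarrow> A j i \<in> component R (\<beta> j - \<alpha> i)"
    "\<And>i j. i \<in> I \<Longrightarrow> j \<in> J \<Longrightarrow> B i j \<in> carrier R"
    "left_inverse_matrix R I J B A" "left_inverse_matrix R J I A B"
proof -
  obtain f where f: "right_linear R I J f" and bij: "bij_betw f (tuples R I) (tuples R J)"
    and deg: "\<And>\<gamma> x. x \<in> (\<Pi>\<^sub>E i\<in>I. component R (\<alpha> i + \<gamma>)) \<Longrightarrow>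
      f x \<in> (\<Pi>\<^sub>E j\<in>J. component R (\<beta> j + \<gamma>))"
    using iso unfolding graded_isomorphic_shift_sums_iff by blast
  define g where "g = inv_into (tuples R I) f"
  have g: "right_linear R J I g"
    unfolding g_def using f bij by (rule right_linear_inverse)
  have gf: "g (f x) = x" if "x \<in> tuples R I" for x
    unfolding g_def using bij that by (rule bij_betw_inv_into_left)
  have fg: "f (g y) = y" if "y \<in> tuples R J" for y
    unfolding g_def using bij that by (rule bij_betw_inv_into_right)
  show thesis
  proof (rule that)
    fix j i assume j: "j \<in> J" and i: "i \<in> I"
    have "unit_tuple R I i \<in> (\<Pi>\<^sub>E k\<in>I. component R (\<alpha> k + - \<alpha> i))"
      using component_one component_zero by (auto simp: unit_tuple_def)
    from deg[OF this] j show "f (unit_tuple R I i) j \<in> component R (\<beta> j - \<alpha> i)"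
      by (auto simp: PiE_iff)
  next
    fix i j assume "i \<in> I" "j \<in> J"
    then show "g (unit_tuple R J j) i \<in> carrier R"
      using right_linearD(1)[OF g unit_tuple_closed] by auto
  qed (use fin f g gf fg in \<open>auto intro: left_inverse_matrix_of_right_linear\<close>)
qed

text \<open>Conversely, an entry of degree \<open>\<beta> j - \<alpha> i\<close> carries degree \<open>\<alpha> i + \<gamma>\<close> to degree \<open>\<beta> j + \<gamma>\<close>, which are
  the components of degree \<open>\<gamma>\<close> in the two shifts.\<close>

lemma graded_isomorphic_of_homogeneous_matrices:
  assumes fin: "finite I" "finite J"
    and A: "\<And>j i. j \<in> J \<Longrightarrow> i \<in> I \<Longrightarrow> A j i \<in> component R (\<beta> j - \<alpha> i)"
    and B: "\<And>i j. i \<in> I \<Longrightarrow> j \<in> J \<Longrightarrow> B i j \<in> carrier R"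
    and inv: "left_inverse_matrix R I J B A" "left_inverse_matrix R J I A B"
  shows "graded_isomorphic R
    (direct_sum I (\<lambda>i. shift R (\<alpha> i))) (direct_sum J (\<lambda>j. shift R (\<beta> j)))"
  unfolding graded_isomorphic_shift_sums_iff
proof (intro exI conjI allI ballI)
  let ?f = "matrix_map R I J A" and ?g = "matrix_map R J I B"
  have Ac: "\<And>j i. j \<in> J \<Longrightarrow> i \<in> I \<Longrightarrow> A j i \<in> carrier R"
    using A component_closed by blast
  show f: "right_linear R I J ?f"
    using Ac by (rule right_linear_matrix_map)
  have g: "right_linear R J I ?g"
    using B by (rule right_linear_matrix_map)
  show "bij_betw ?f (tuples R I) (tuples R J)"
  proof (rule bij_betw_byWitness[where f' = ?g])
    show "\<forall>x \<in> tuples R I. ?g (?f x) = x"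
      using matrix_map_left_inverse[OF fin Ac B inv(1)] by blast
    show "\<forall>y \<in> tuples R J. ?f (?g y) = y"
      using matrix_map_left_inverse[OF fin(2,1) B Ac inv(2)] by blast
  qed (use right_linearD(1)[OF f] right_linearD(1)[OF g] in blast)+
  fix \<gamma> x assume x: "x \<in> (\<Pi>\<^sub>E i\<in>I. component R (\<alpha> i + \<gamma>))"
  have "A j i \<otimes> x i \<in> component R (\<beta> j + \<gamma>)" if "j \<in> J" "i \<in> I" for j i
  proof -
    have "A j i \<otimes> x i \<in> component R ((\<beta> j - \<alpha> i) + (\<alpha> i + \<gamma>))"
      using x that by (intro component_mult A) auto
    then show ?thesis by (simp add: algebra_simps)
  qed
  then show "?f x \<in> (\<Pi>\<^sub>E j\<in>J. component R (\<beta> j + \<gamma>))"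
    by (auto simp: matrix_map_def intro!: component_finsum)
qed

end

text \<open>A graded isomorphism over \<open>R\<close> amounts to a pair of mutually inverse matrices, the first of
  which has homogeneous entries; their images under \<open>h\<close> form such a pair over \<open>S\<close>, with the same sizes
  and the same shifts.\<close>

theorem gr_IBN_of_graded_hom:
  assumes R: "weakly_graded_ring R" and S: "weakly_graded_ring S" and h: "h \<in> ring_hom R S"
    and deg: "\<And>\<gamma> a. a \<in> component R \<gamma> \<Longrightarrow> h a \<in> component S \<gamma>"
    and IBN: "gr_IBN S"
  shows "gr_IBN R"
  unfolding gr_IBN_def
proof (intro allI impI)
  fix m n :: nat and \<alpha> \<beta> :: "nat \<Rightarrow> 'b"
  assume pos: "m > 0" "n > 0"
    and iso: "graded_isomorphic R
      (direct_sum {..<m} (\<lambda>i. shift R (\<alpha> i))) (direct_sum {..<n} (\<lambda>j. shift R (\<beta> j)))"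
  interpret R: weakly_graded_ring R by fact
  interpret S: weakly_graded_ring S by fact
  interpret ring_hom_ring R S h
    by (rule ring_hom_ringI2[OF R.ring_axioms S.ring_axioms h])
  obtain A B where A: "\<And>j i. j \<in> {..<n} \<Longrightarrow> i \<in> {..<m} \<Longrightarrow> A j i \<in> component R (\<beta> j - \<alpha> i)"
    and B: "\<And>i j. i \<in> {..<m} \<Longrightarrow> j \<in> {..<n} \<Longrightarrow> B i j \<in> carrier R"
    and inv: "left_inverse_matrix R {..<m} {..<n} B A" "left_inverse_matrix R {..<n} {..<m} A B"
    by (rule R.homogeneous_matrices_of_graded_isomorphic[OF finite_lessThan finite_lessThan iso])
      (rule that, auto)
  have Ac: "\<And>j i. j \<in> {..<n} \<Longrightarrow> i \<in> {..<m} \<Longrightarrow> A j i \<in> carrier R"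
    using A R.component_closed by blast
  have "graded_isomorphic S
      (direct_sum {..<m} (\<lambda>i. shift S (\<alpha> i))) (direct_sum {..<n} (\<lambda>j. shift S (\<beta> j)))"
  proof (rule S.graded_isomorphic_of_homogeneous_matrices)
    show "left_inverse_matrix S {..<m} {..<n} (\<lambda>i j. h (B i j)) (\<lambda>j i. h (A j i))"
      by (rule left_inverse_matrix_hom[OF Ac B inv(1)])
    show "left_inverse_matrix S {..<n} {..<m} (\<lambda>j i. h (A j i)) (\<lambda>i j. h (B i j))"
      by (rule left_inverse_matrix_hom[OF B Ac inv(2)])
  qed (use A B deg in auto)
  then show "m = n"
    using IBN pos unfolding gr_IBN_def by blast
qed

section \<open>Free algebras\<close>

lemma letters_zero [simp]: "letters 0 = []"
  by (simp add: zero_word_def)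

lemma letters_plus [simp]: "letters (u + v) = letters u @ letters v"
  by (simp add: plus_word_def)

lemma word_eq_zero_iff: "w = 0 \<longleftrightarrow> letters w = []"
  by (cases w) (simp add: zero_word_def)

lemma word_degree_plus: "word_degree (u + v) = word_degree u + word_degree v"
  by (simp add: word_degree_def)

lemma keys_monomial [simp]: "Poly_Mapping.keys (monomial x) = {Word [x]}"
  by (simp add: monomial_def)

lemma poly_mapping_eq_sum_single:
  "p = (\<Sum>w\<in>Poly_Mapping.keys p. Poly_Mapping.single w (Poly_Mapping.lookup p w))"
  by (rule poly_mapping_eqI) (auto simp: lookup_sum lookup_single when_def in_keys_iff sum.If_cases)

lemma free_algebra_simps [simp]:
  "mult (free_algebra X) = (*)" "one (free_algebra X) = 1"
  "zero (free_algebra X) = 0" "add (free_algebra X) = (+)"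
  by (simp_all add: free_algebra_def)

lemma mem_free_algebra_iff:
  "p \<in> carrier (free_algebra X) \<longleftrightarrow> (\<forall>w \<in> Poly_Mapping.keys p. set (letters w) \<subseteq> X)"
  by (simp add: free_algebra_def)

lemma free_algebra_closed:
  fixes p q :: "'x word \<Rightarrow>\<^sub>0 'k::field"
  assumes p: "p \<in> carrier (free_algebra X)" and q: "q \<in> carrier (free_algebra X)"
  shows "p + q \<in> carrier (free_algebra X)" "p - q \<in> carrier (free_algebra X)"
    "p * q \<in> carrier (free_algebra X)"
proof -
  show "p + q \<in> carrier (free_algebra X)"
    using p q keys_add[of p q] unfolding mem_free_algebra_iff by blast
  show "p - q \<in> carrier (free_algebra X)"
    using p q keys_diff[of p q] unfolding mem_free_algebra_iff by blast
  have "set (letters w) \<subseteq> X" if w: "w \<in> Poly_Mapping.keys (p * q)" for w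
  proof -
    obtain u v where "w = u + v" "u \<in> Poly_Mapping.keys p" "v \<in> Poly_Mapping.keys q"
      using w keys_mult[of p q] by blast
    then show ?thesis
      using p q by (simp add: mem_free_algebra_iff)
  qed
  then show "p * q \<in> carrier (free_algebra X)"
    unfolding mem_free_algebra_iff by blast
qed

lemma zero_in_free_algebra [simp]: "0 \<in> carrier (free_algebra X)"
  by (simp add: mem_free_algebra_iff)

lemma sum_in_free_algebra:
  "(\<And>i. i \<in> I \<Longrightarrow> p i \<in> carrier (free_algebra X)) \<Longrightarrow> sum p I \<in> carrier (free_algebra X)"
  by (induction I rule: infinite_finite_induct) (simp_all add: free_algebra_closed)

lemma monomial_in_free_algebra: "x \<in> X \<Longrightarrow> monomial x \<in> carrier (free_algebra X)"
  by (simp add: mem_free_algebra_iff)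

lemma ring_free_algebra: "ring (free_algebra X :: ('x word \<Rightarrow>\<^sub>0 'k::field) ring)" (is "ring ?F")
proof (rule ringI)
  show "abelian_group ?F"
  proof (rule abelian_groupI)
    fix p assume p: "p \<in> carrier ?F"
    then have "0 - p \<in> carrier ?F" by (intro free_algebra_closed zero_in_free_algebra)
    moreover have "0 - p \<oplus>\<^bsub>?F\<^esub> p = \<zero>\<^bsub>?F\<^esub>" by simp
    ultimately show "\<exists>q \<in> carrier ?F. q \<oplus>\<^bsub>?F\<^esub> p = \<zero>\<^bsub>?F\<^esub>" by blast
  qed (simp_all add: free_algebra_closed algebra_simps)
  show "Group.monoid ?F"
    by (rule monoidI) (simp_all add: free_algebra_closed mem_free_algebra_iff[of 1] mult.assoc)
qed (simp_all add: algebra_simps)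

lemma minus_free_algebra:
  fixes p q :: "'x word \<Rightarrow>\<^sub>0 'k::field"
  assumes "p \<in> carrier (free_algebra X)" "q \<in> carrier (free_algebra X)"
  shows "p \<ominus>\<^bsub>free_algebra X\<^esub> q = p - q"
proof -
  interpret ring "free_algebra X :: ('x word \<Rightarrow>\<^sub>0 'k) ring" by (rule ring_free_algebra)
  have "- q \<in> carrier (free_algebra X)"
    using free_algebra_closed(2)[OF zero_in_free_algebra assms(2)] by simp
  then have "\<ominus>\<^bsub>free_algebra X\<^esub> q = - q"
    using assms by (intro minus_equality) simp_all
  then show ?thesis by (simp add: a_minus_def)
qed

lemma mem_nonunital_free_algebra_iff:
  "p \<in> nonunital_free_algebra X \<longleftrightarrow> p \<in> carrier (free_algebra X) \<and> 0 \<notin> Poly_Mapping.keys p"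
  by (simp add: nonunital_free_algebra_def)

lemma nonunital_free_algebra_closed:
  fixes p q :: "'x word \<Rightarrow>\<^sub>0 'k::field"
  assumes p: "p \<in> nonunital_free_algebra X" and q: "q \<in> nonunital_free_algebra X"
  shows "p + q \<in> nonunital_free_algebra X" "p - q \<in> nonunital_free_algebra X"
    "p * q \<in> nonunital_free_algebra X"
proof -
  note closed = free_algebra_closed[of p X q]
  show "p + q \<in> nonunital_free_algebra X"
    using p q closed(1) keys_add[of p q] unfolding mem_nonunital_free_algebra_iff by blast
  show "p - q \<in> nonunital_free_algebra X"
    using p q closed(2) keys_diff[of p q] unfolding mem_nonunital_free_algebra_iff by blast
  have "0 \<notin> Poly_Mapping.keys (p * q)"
  proof
    assume "0 \<in> Poly_Mapping.keys (p * q)"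
    then obtain u v where "u + v = 0" and u: "u \<in> Poly_Mapping.keys p"
      using keys_mult[of p q] by fastforce
    then have "u = 0"
      by (simp add: word_eq_zero_iff)
    then show False
      using u p by (simp add: mem_nonunital_free_algebra_iff)
  qed
  then show "p * q \<in> nonunital_free_algebra X"
    using p q closed(3) unfolding mem_nonunital_free_algebra_iff by blast
qed

lemma zero_in_nonunital_free_algebra [simp]: "0 \<in> nonunital_free_algebra X"
  by (simp add: mem_nonunital_free_algebra_iff)

lemma monomial_in_nonunital_free_algebra: "x \<in> X \<Longrightarrow> monomial x \<in> nonunital_free_algebra X"
  by (simp add: mem_nonunital_free_algebra_iff monomial_in_free_algebra zero_word_def)

lemma sum_in_nonunital_free_algebra:
  "(\<And>i. i \<in> I \<Longrightarrow> p i \<in> nonunital_free_algebra X) \<Longrightarrow> sum p I \<in> nonunital_free_algebra X"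
  by (induction I rule: infinite_finite_induct) (simp_all add: nonunital_free_algebra_closed)

section \<open>The Leavitt path algebra as a graded ring\<close>

lemma leavitt_relatorsI:
  "v \<in> verts E \<Longrightarrow> w \<in> verts E \<Longrightarrow>
    vtx v * vtx w - (if v = w then vtx w else 0) \<in> leavitt_relators E"
  "e \<in> arcs E \<Longrightarrow> vtx (tail E e) * edg e - edg e \<in> leavitt_relators E"
  "e \<in> arcs E \<Longrightarrow> edg e * vtx (head E e) - edg e \<in> leavitt_relators E"
  "e \<in> arcs E \<Longrightarrow> vtx (head E e) * gho e - gho e \<in> leavitt_relators E"
  "e \<in> arcs E \<Longrightarrow> gho e * vtx (tail E e) - gho e \<in> leavitt_relators E"
  "e \<in> arcs E \<Longrightarrow> f \<in> arcs E \<Longrightarrow>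
    gho e * edg f - (if e = f then vtx (head E e) else 0) \<in> leavitt_relators E"
  "regular_vertex E v \<Longrightarrow> vtx v - (\<Sum>e \<in> out_arcs E v. edg e * gho e) \<in> leavitt_relators E"
  unfolding leavitt_relators_def
  (* Without explicit witnesses, unification would identify the two vertices, or the two edges,
     in the relators that contain a conditional. *)
  subgoal by (intro UnI1 CollectI exI[of _ v] exI[of _ w] conjI refl)
  subgoal by blast
  subgoal by blast
  subgoal by blast
  subgoal by blast
  subgoal by (rule UnI1, rule UnI2) (intro CollectI exI[of _ e] exI[of _ f] conjI refl)
  subgoal by (rule UnI2) blast
  done

context wf_digraph
begin

lemma leavitt_relators_closed: "leavitt_relators G \<subseteq> carrier (free_algebra (generators G))"
proof -
  have "vtx v \<in> carrier (free_algebra (generators G))" if "v \<in> verts G" for v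
    using that by (intro monomial_in_free_algebra) (simp add: generators_def)
  moreover have "edg e \<in> carrier (free_algebra (generators G))"
    "gho e \<in> carrier (free_algebra (generators G))" if "e \<in> arcs G" for e
    using that by (auto intro!: monomial_in_free_algebra simp: generators_def)
  ultimately show ?thesis
    unfolding leavitt_relators_def
    by (auto intro!: free_algebra_closed sum_in_free_algebra simp: regular_vertex_def out_arcs_def)
qed

lemma ideal_leavitt_ideal: "ideal (leavitt_ideal G) (free_algebra (generators G))"
  unfolding leavitt_ideal_def
  by (rule ring.genideal_ideal[OF ring_free_algebra leavitt_relators_closed])

lemma leavitt_relators_subset: "leavitt_relators G \<subseteq> leavitt_ideal G"
  unfolding leavitt_ideal_def
  by (rule ring.genideal_self[OF ring_free_algebra leavitt_relators_closed])

lemma leavitt_ideal_closed: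
  fixes p q :: "('a, 'b) generator word \<Rightarrow>\<^sub>0 'k::field"
  assumes "p \<in> leavitt_ideal G"
  shows "q \<in> leavitt_ideal G \<Longrightarrow> p + q \<in> leavitt_ideal G"
    and "q \<in> leavitt_ideal G \<Longrightarrow> p - q \<in> leavitt_ideal G"
    and "q \<in> carrier (free_algebra (generators G)) \<Longrightarrow> p * q \<in> leavitt_ideal G"
    and "q \<in> carrier (free_algebra (generators G)) \<Longrightarrow> q * p \<in> leavitt_ideal G"
proof -
  interpret ideal "leavitt_ideal G" "free_algebra (generators G) :: (_ word \<Rightarrow>\<^sub>0 'k) ring"
    by (rule ideal_leavitt_ideal)
  show "p + q \<in> leavitt_ideal G" if "q \<in> leavitt_ideal G"
    using additive_subgroup.a_closed[OF is_additive_subgroup assms that] by simp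
  show "p - q \<in> leavitt_ideal G" if "q \<in> leavitt_ideal G"
    using additive_subgroup.a_closed[OF is_additive_subgroup assms
        additive_subgroup.a_inv_closed[OF is_additive_subgroup that]]
      minus_free_algebra[OF Icarr[OF assms] Icarr[OF that]]
    by (simp add: a_minus_def)
  show "p * q \<in> leavitt_ideal G" "q * p \<in> leavitt_ideal G"
    if "q \<in> carrier (free_algebra (generators G))"
    using I_l_closed[OF assms that] I_r_closed[OF assms that] by simp_all
qed

lemma zero_in_leavitt_ideal: "0 \<in> leavitt_ideal G"
  using additive_subgroup.zero_closed[OF ideal.axioms(1)[OF ideal_leavitt_ideal]] by simp

lemma sum_in_leavitt_ideal:
  "(\<And>i. i \<in> I \<Longrightarrow> p i \<in> leavitt_ideal G) \<Longrightarrow> sum p I \<in> leavitt_ideal G"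
  by (induction I rule: infinite_finite_induct) (simp_all add: leavitt_ideal_closed zero_in_leavitt_ideal)

lemma leavitt_class_eq_iff:
  fixes p q :: "('a, 'b) generator word \<Rightarrow>\<^sub>0 'k::field"
  assumes "p \<in> carrier (free_algebra (generators G))" "q \<in> carrier (free_algebra (generators G))"
  shows "leavitt_class G p = leavitt_class G q \<longleftrightarrow> p - q \<in> leavitt_ideal G"
  using ring.quotient_eq_iff_same_a_r_cos[OF ring_free_algebra ideal_leavitt_ideal assms]
  unfolding leavitt_class_def minus_free_algebra[OF assms] by simp

end

text \<open>The unit of the Leavitt path algebra of a finite graph, on the level of the free algebra. That
  it acts as a unit is a consequence of the defining relations.\<close>

abbreviation vertex_sum :: "('v, 'e) pre_digraph \<Rightarrow> ('v, 'e) generator word \<Rightarrow>\<^sub>0 'k::field" where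
  "vertex_sum E \<equiv> \<Sum>v\<in>verts E. vtx v"

context fin_digraph
begin

lemma vertex_sum_in_nonunital: "vertex_sum G \<in> nonunital_free_algebra (generators G)"
  by (intro sum_in_nonunital_free_algebra monomial_in_nonunital_free_algebra)
    (simp add: generators_def)

lemma vertex_sum_closed: "vertex_sum G \<in> carrier (free_algebra (generators G))"
  by (rule conjunct1[OF vertex_sum_in_nonunital[unfolded mem_nonunital_free_algebra_iff]])

lemma vertex_sum_mult_vertex:
  assumes w: "w \<in> verts G"
  shows "vertex_sum G * vtx w - (vtx w :: ('a, 'b) generator word \<Rightarrow>\<^sub>0 'k::field) \<in> leavitt_ideal G"
    and "vtx w * vertex_sum G - (vtx w :: ('a, 'b) generator word \<Rightarrow>\<^sub>0 'k) \<in> leavitt_ideal G"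
proof -
  have r: "vtx v * (vtx w :: ('a, 'b) generator word \<Rightarrow>\<^sub>0 'k) - (if v = w then vtx w else 0) \<in> leavitt_ideal G"
    if "v \<in> verts G" "w \<in> verts G" for v w
    using that by (intro subsetD[OF leavitt_relators_subset]) (auto simp: leavitt_relators_def)
  have "vertex_sum G * vtx w - (vtx w :: ('a, 'b) generator word \<Rightarrow>\<^sub>0 'k)
      = (\<Sum>v\<in>verts G. vtx v * vtx w - (if v = w then vtx w else 0))"
    using w by (simp add: sum_distrib_right sum_subtractf)
  then show "vertex_sum G * vtx w - (vtx w :: ('a, 'b) generator word \<Rightarrow>\<^sub>0 'k) \<in> leavitt_ideal G"
    using w r by (simp only: sum_in_leavitt_ideal)
  have "vtx w * vertex_sum G - (vtx w :: ('a, 'b) generator word \<Rightarrow>\<^sub>0 'k)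
      = (\<Sum>v\<in>verts G. vtx w * vtx v - (if w = v then vtx v else 0))"
    using w by (simp add: sum_distrib_left sum_subtractf)
  then show "vtx w * vertex_sum G - (vtx w :: ('a, 'b) generator word \<Rightarrow>\<^sub>0 'k) \<in> leavitt_ideal G"
    using w r by (simp only: sum_in_leavitt_ideal)
qed

text \<open>Modulo the ideal, \<open>y = v y\<close>, so that the sum of the vertices acts on \<open>y\<close> through its action on \<open>v\<close>.
  This handles edges and ghost edges at once; the next lemma is the mirror image.\<close>

lemma vertex_sum_mult_of_source:
  fixes y :: "('a, 'b) generator word \<Rightarrow>\<^sub>0 'k::field"
  assumes v: "v \<in> verts G" and y: "y \<in> carrier (free_algebra (generators G))"
    and vy: "vtx v * y - y \<in> leavitt_ideal G"
  shows "vertex_sum G * y - y \<in> leavitt_ideal G"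
proof -
  have "vertex_sum G * y - y
      = (vertex_sum G * vtx v - vtx v) * y + (vtx v * y - y) - vertex_sum G * (vtx v * y - y)"
    by (simp add: algebra_simps)
  then show ?thesis
    using leavitt_ideal_closed(2)[OF
        leavitt_ideal_closed(1)[OF leavitt_ideal_closed(3)[OF vertex_sum_mult_vertex(1)[OF v] y] vy]
        leavitt_ideal_closed(4)[OF vy vertex_sum_closed]]
    by (simp only:)
qed

lemma mult_vertex_sum_of_range:
  fixes y :: "('a, 'b) generator word \<Rightarrow>\<^sub>0 'k::field"
  assumes v: "v \<in> verts G" and y: "y \<in> carrier (free_algebra (generators G))"
    and yv: "y * vtx v - y \<in> leavitt_ideal G"
  shows "y * vertex_sum G - y \<in> leavitt_ideal G"
proof -
  have "y * vertex_sum G - y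
      = y * (vtx v * vertex_sum G - vtx v) + (y * vtx v - y) - (y * vtx v - y) * vertex_sum G"
    by (simp add: algebra_simps)
  then show ?thesis
    using leavitt_ideal_closed(2)[OF
        leavitt_ideal_closed(1)[OF leavitt_ideal_closed(4)[OF vertex_sum_mult_vertex(2)[OF v] y] yv]
        leavitt_ideal_closed(3)[OF yv vertex_sum_closed]]
    by (simp only:)
qed

lemma vertex_sum_mult_generator:
  fixes x :: "('a, 'b) generator"
  defines "y \<equiv> monomial x :: ('a, 'b) generator word \<Rightarrow>\<^sub>0 'k::field"
  assumes x: "x \<in> generators G"
  shows "vertex_sum G * y - y \<in> leavitt_ideal G"
    and "y * vertex_sum G - y \<in> leavitt_ideal G"
proof -
  have closed: "y \<in> carrier (free_algebra (generators G))"
    unfolding y_def using x by (rule monomial_in_free_algebra)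
  have rel: "\<rho> \<in> leavitt_ideal G" if "\<rho> \<in> leavitt_relators G"
    for \<rho> :: "('a, 'b) generator word \<Rightarrow>\<^sub>0 'k"
    using that leavitt_relators_subset by blast
  consider v where "x = Vertex v" "v \<in> verts G" | e where "x = Edge e" "e \<in> arcs G"
    | e where "x = Ghost e" "e \<in> arcs G"
    using x by (auto simp: generators_def)
  note cases = this
  show "vertex_sum G * y - y \<in> leavitt_ideal G"
  proof (cases rule: cases)
    case 2
    then show ?thesis
      by (intro vertex_sum_mult_of_source[OF tail_in_verts closed] rel)
        (auto simp: leavitt_relators_def y_def)
  next
    case 3
    then show ?thesis
      by (intro vertex_sum_mult_of_source[OF head_in_verts closed] rel)
        (auto simp: leavitt_relators_def y_def)
  qed (simp add: vertex_sum_mult_vertex y_def)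
  show "y * vertex_sum G - y \<in> leavitt_ideal G"
  proof (cases rule: cases)
    case 2
    then show ?thesis
      by (intro mult_vertex_sum_of_range[OF head_in_verts closed] rel)
        (auto simp: leavitt_relators_def y_def)
  next
    case 3
    then show ?thesis
      by (intro mult_vertex_sum_of_range[OF tail_in_verts closed] rel)
        (auto simp: leavitt_relators_def y_def)
  qed (simp add: vertex_sum_mult_vertex y_def)
qed

text \<open>Every word that occurs in \<open>p\<close> is nonempty, so it has a first and a last letter, and the sum of
  the vertices is absorbed by that letter.\<close>

lemma vertex_sum_unit:
  fixes p :: "('a, 'b) generator word \<Rightarrow>\<^sub>0 'k::field"
  assumes p: "p \<in> nonunital_free_algebra (generators G)"
  shows "vertex_sum G * p - p \<in> leavitt_ideal G" "p * vertex_sum G - p \<in> leavitt_ideal G"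
proof -
  let ?s = "\<lambda>w. Poly_Mapping.single w (Poly_Mapping.lookup p w)"
  have left: "vertex_sum G * ?s w - ?s w \<in> leavitt_ideal G"
    and right: "?s w * vertex_sum G - ?s w \<in> leavitt_ideal G" if w: "w \<in> Poly_Mapping.keys p" for w
  proof -
    have nonempty: "letters w \<noteq> []" and letters: "set (letters w) \<subseteq> generators G"
      using p w word_eq_zero_iff[of w] by (auto simp: mem_nonunital_free_algebra_iff mem_free_algebra_iff)
    obtain x xs where w1: "letters w = x # xs"
      using nonempty by (cases "letters w") auto
    then have "w = Word [x] + Word xs"
      by (cases w) (simp add: plus_word_def)
    then have s1: "?s w = monomial x * Poly_Mapping.single (Word xs) (Poly_Mapping.lookup p w)"
      by (simp add: monomial_def mult_single)
    have "vertex_sum G * ?s w - ?s w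
        = (vertex_sum G * monomial x - monomial x) * Poly_Mapping.single (Word xs) (Poly_Mapping.lookup p w)"
      unfolding s1 by (simp add: algebra_simps)
    then show "vertex_sum G * ?s w - ?s w \<in> leavitt_ideal G"
      using letters w1 vertex_sum_mult_generator(1)[of x]
      by (simp only:) (intro leavitt_ideal_closed(3), auto simp: mem_free_algebra_iff)
    obtain y ys where w2: "letters w = ys @ [y]"
      using nonempty by (cases "letters w" rule: rev_cases) auto
    then have "w = Word ys + Word [y]"
      by (cases w) (simp add: plus_word_def)
    then have s2: "?s w = Poly_Mapping.single (Word ys) (Poly_Mapping.lookup p w) * monomial y"
      by (simp add: monomial_def mult_single)
    have "?s w * vertex_sum G - ?s w
        = Poly_Mapping.single (Word ys) (Poly_Mapping.lookup p w) * (monomial y * vertex_sum G - monomial y)"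
      unfolding s2 by (simp add: algebra_simps)
    then show "?s w * vertex_sum G - ?s w \<in> leavitt_ideal G"
      using letters w2 vertex_sum_mult_generator(2)[of y]
      by (simp only:) (intro leavitt_ideal_closed(4), auto simp: mem_free_algebra_iff)
  qed
  have p_eq: "(\<Sum>w\<in>Poly_Mapping.keys p. ?s w) = p"
    by (rule poly_mapping_eq_sum_single[symmetric])
  have "vertex_sum G * p - p = (\<Sum>w\<in>Poly_Mapping.keys p. vertex_sum G * ?s w - ?s w)"
    by (simp only: sum_subtractf sum_distrib_left[symmetric] p_eq)
  then show "vertex_sum G * p - p \<in> leavitt_ideal G"
    using left by (simp only: sum_in_leavitt_ideal)
  have "p * vertex_sum G - p = (\<Sum>w\<in>Poly_Mapping.keys p. ?s w * vertex_sum G - ?s w)"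
    by (simp only: sum_subtractf sum_distrib_right[symmetric] p_eq)
  then show "p * vertex_sum G - p \<in> leavitt_ideal G"
    using right by (simp only: sum_in_leavitt_ideal)
qed

end

context wf_digraph
begin

lemma leavitt_path_algebra_simps:
  fixes K :: "'k::field itself"
  shows "carrier (leavitt_path_algebra K G) = leavitt_class G ` nonunital_free_algebra (generators G)"
    and "one (leavitt_path_algebra K G) = leavitt_class G (vertex_sum G)"
    and "zero (leavitt_path_algebra K G) = leavitt_class G 0"
    and "component (leavitt_path_algebra K G) n =
      leavitt_class G ` {p \<in> nonunital_free_algebra (generators G).
        \<forall>w \<in> Poly_Mapping.keys p. word_degree w = n}"
proof -
  have "leavitt_class G (0 :: ('a, 'b) generator word \<Rightarrow>\<^sub>0 'k) = leavitt_ideal G"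
    using ring.a_rcos_zero[OF ring_free_algebra ideal_leavitt_ideal zero_in_leavitt_ideal]
    unfolding leavitt_class_def .
  then show "zero (leavitt_path_algebra K G) = leavitt_class G 0"
    by (simp add: leavitt_path_algebra_def FactRing_def Let_def)
qed (simp_all add: leavitt_path_algebra_def Let_def)

lemma leavitt_class_add:
  fixes p q :: "('a, 'b) generator word \<Rightarrow>\<^sub>0 'k::field"
  assumes "p \<in> carrier (free_algebra (generators G))" "q \<in> carrier (free_algebra (generators G))"
  shows "leavitt_class G p \<oplus>\<^bsub>leavitt_path_algebra TYPE('k) G\<^esub> leavitt_class G q = leavitt_class G (p + q)"
  using ideal.a_rcos_sum[OF ideal_leavitt_ideal assms]
  by (simp add: leavitt_path_algebra_def FactRing_def leavitt_class_def Let_def)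

lemma leavitt_class_mult:
  fixes p q :: "('a, 'b) generator word \<Rightarrow>\<^sub>0 'k::field"
  assumes "p \<in> carrier (free_algebra (generators G))" "q \<in> carrier (free_algebra (generators G))"
  shows "leavitt_class G p \<otimes>\<^bsub>leavitt_path_algebra TYPE('k) G\<^esub> leavitt_class G q = leavitt_class G (p * q)"
  using ideal.rcoset_mult_add[OF ideal_leavitt_ideal assms]
  by (simp add: leavitt_path_algebra_def FactRing_def leavitt_class_def Let_def)

end

context fin_digraph
begin

text \<open>Every computation happens with representatives: elements are classes of polynomials without
  constant term, and classes add and multiply as their representatives do. Products of homogeneous
  elements are homogeneous because the degree of words is additive under concatenation.\<close>

lemma weakly_graded_ring_leavitt_path_algebra:
  "weakly_graded_ring (leavitt_path_algebra TYPE('k::field) G)"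
proof -
  let ?L = "leavitt_path_algebra TYPE('k) G"
  let ?A = "nonunital_free_algebra (generators G) :: (('a, 'b) generator word \<Rightarrow>\<^sub>0 'k) set"
  let ?c = "leavitt_class G :: (('a, 'b) generator word \<Rightarrow>\<^sub>0 'k) \<Rightarrow> _"
  note A_closed = nonunital_free_algebra_closed
  have AF: "p \<in> carrier (free_algebra (generators G))" if "p \<in> ?A" for p
    using that by (simp add: mem_nonunital_free_algebra_iff)
  have add: "?c p \<oplus>\<^bsub>?L\<^esub> ?c q = ?c (p + q)" and mult: "?c p \<otimes>\<^bsub>?L\<^esub> ?c q = ?c (p * q)"
    if "p \<in> ?A" "q \<in> ?A" for p q
    using that by (simp_all add: AF leavitt_class_add leavitt_class_mult)
  have unit: "?c (vertex_sum G * p) = ?c p" "?c (p * vertex_sum G) = ?c p" if p: "p \<in> ?A" for p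
    using vertex_sum_unit[OF p] p
    by (simp_all add: leavitt_class_eq_iff AF free_algebra_closed vertex_sum_closed)
  have L_simps: "carrier ?L = ?c ` ?A" "\<one>\<^bsub>?L\<^esub> = ?c (vertex_sum G)" "\<zero>\<^bsub>?L\<^esub> = ?c 0"
    by (rule leavitt_path_algebra_simps)+
  have "ring ?L"
  proof (rule ringI)
    show "abelian_group ?L"
    proof (rule abelian_groupI)
      fix x assume "x \<in> carrier ?L"
      then obtain p where p: "p \<in> ?A" "x = ?c p" by (auto simp: L_simps)
      have "?c (0 - p) \<in> carrier ?L" "?c (0 - p) \<oplus>\<^bsub>?L\<^esub> x = \<zero>\<^bsub>?L\<^esub>"
        using p A_closed(2)[OF zero_in_nonunital_free_algebra p(1)]
        by (simp_all add: L_simps add del: diff_0)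
      then show "\<exists>y \<in> carrier ?L. y \<oplus>\<^bsub>?L\<^esub> x = \<zero>\<^bsub>?L\<^esub>" by blast
    qed (auto simp: L_simps add A_closed algebra_simps)
    show "Group.monoid ?L"
      by (rule monoidI) (auto simp: L_simps mult A_closed mult.assoc unit vertex_sum_in_nonunital)
  qed (auto simp: L_simps add mult A_closed algebra_simps)
  moreover have "weakly_graded_ring_axioms ?L"
  proof
    fix a b m n
    show "a \<in> carrier ?L" if "a \<in> component ?L m"
      using that by (auto simp: leavitt_path_algebra_simps)
    show "\<zero>\<^bsub>?L\<^esub> \<in> component ?L m"
      by (auto simp: leavitt_path_algebra_simps)
    show "\<one>\<^bsub>?L\<^esub> \<in> component ?L 0"
    proof -
      have "word_degree w = 0" if w: "w \<in> Poly_Mapping.keys (vertex_sum G :: _ \<Rightarrow>\<^sub>0 'k)" for w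
        using subsetD[OF keys_sum w] by (auto simp: word_degree_def)
      then show ?thesis
        by (auto simp: leavitt_path_algebra_simps vertex_sum_in_nonunital)
    qed
    show "a \<oplus>\<^bsub>?L\<^esub> b \<in> component ?L m" if "a \<in> component ?L m" "b \<in> component ?L m"
    proof -
      obtain p q where p: "p \<in> ?A" "\<forall>w \<in> Poly_Mapping.keys p. word_degree w = m" "a = ?c p"
        and q: "q \<in> ?A" "\<forall>w \<in> Poly_Mapping.keys q. word_degree w = m" "b = ?c q"
        using \<open>a \<in> component ?L m\<close> \<open>b \<in> component ?L m\<close> by (auto simp: leavitt_path_algebra_simps)
      have "\<forall>w \<in> Poly_Mapping.keys (p + q). word_degree w = m"
        using keys_add[of p q] p(2) q(2) by blast
      then show ?thesis
        using p q by (simp add: leavitt_path_algebra_simps add A_closed)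
    qed
    show "a \<otimes>\<^bsub>?L\<^esub> b \<in> component ?L (m + n)" if "a \<in> component ?L m" "b \<in> component ?L n"
    proof -
      obtain p q where p: "p \<in> ?A" "\<forall>w \<in> Poly_Mapping.keys p. word_degree w = m" "a = ?c p"
        and q: "q \<in> ?A" "\<forall>w \<in> Poly_Mapping.keys q. word_degree w = n" "b = ?c q"
        using \<open>a \<in> component ?L m\<close> \<open>b \<in> component ?L n\<close> by (auto simp: leavitt_path_algebra_simps)
      have "word_degree w = m + n" if w: "w \<in> Poly_Mapping.keys (p * q)" for w
      proof -
        obtain u v where "w = u + v" "u \<in> Poly_Mapping.keys p" "v \<in> Poly_Mapping.keys q"
          using w keys_mult[of p q] by blast
        then show ?thesis
          using p(2) q(2) by (simp add: word_degree_plus)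
      qed
      then show ?thesis
        using p q by (simp add: leavitt_path_algebra_simps mult A_closed)
    qed
  qed
  ultimately show ?thesis
    by (rule weakly_graded_ring.intro)
qed

end

section \<open>The homomorphism onto the algebra of the quotient graph\<close>

text \<open>The endomorphism of the free algebra that sends the letters outside \<open>X\<close> to zero and fixes those
  in \<open>X\<close>. Defining it as a truncation of the coefficient function makes its effect on the support
  of a polynomial, hence on degrees, immediate.\<close>

definition restrict_letters :: "'x set \<Rightarrow> ('x word \<Rightarrow>\<^sub>0 'k::field) \<Rightarrow> 'x word \<Rightarrow>\<^sub>0 'k" where
  "restrict_letters X p = Poly_Mapping.mapp (\<lambda>w c. c when set (letters w) \<subseteq> X) p"

lemma lookup_restrict_letters:
  "Poly_Mapping.lookup (restrict_letters X p) w =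
     (Poly_Mapping.lookup p w when set (letters w) \<subseteq> X)"
  by (simp add: restrict_letters_def lookup_mapp when_def in_keys_iff)

lemma restrict_letters_zero [simp]: "restrict_letters X 0 = 0"
  by (rule poly_mapping_eqI) (simp add: lookup_restrict_letters)

lemma restrict_letters_add: "restrict_letters X (p + q) = restrict_letters X p + restrict_letters X q"
  by (rule poly_mapping_eqI) (simp add: lookup_restrict_letters lookup_add when_def)

lemma restrict_letters_diff: "restrict_letters X (p - q) = restrict_letters X p - restrict_letters X q"
  by (rule poly_mapping_eqI) (simp add: lookup_restrict_letters lookup_minus when_def)

lemma restrict_letters_sum: "restrict_letters X (sum p I) = (\<Sum>i\<in>I. restrict_letters X (p i))"
  by (induction I rule: infinite_finite_induct) (simp_all add: restrict_letters_add)

lemma restrict_letters_single: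
  "restrict_letters X (Poly_Mapping.single w c) = (Poly_Mapping.single w c when set (letters w) \<subseteq> X)"
  by (rule poly_mapping_eqI) (auto simp: lookup_restrict_letters lookup_single when_def)

lemma restrict_letters_monomial:
  "restrict_letters X (monomial x) = (if x \<in> X then monomial x else 0)"
  by (simp add: monomial_def restrict_letters_single)

lemma restrict_letters_one: "restrict_letters X 1 = 1"
  using restrict_letters_single[of X 0 1] by simp

text \<open>A concatenation of two words has all its letters in \<open>X\<close> if and only if both words do. By
  bilinearity this settles the claim for sums of single terms.\<close>

lemma restrict_letters_mult: "restrict_letters X (p * q) = restrict_letters X p * restrict_letters X q"
proof -
  let ?s = "\<lambda>p w. Poly_Mapping.single w (Poly_Mapping.lookup p w)"
  have single: "restrict_letters X (?s p u * ?s q v)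
      = restrict_letters X (?s p u) * restrict_letters X (?s q v)" for u v
    by (simp add: restrict_letters_single mult_single when_def)
  have "restrict_letters X ((\<Sum>u\<in>Poly_Mapping.keys p. ?s p u) * (\<Sum>v\<in>Poly_Mapping.keys q. ?s q v))
      = restrict_letters X (\<Sum>u\<in>Poly_Mapping.keys p. ?s p u)
        * restrict_letters X (\<Sum>v\<in>Poly_Mapping.keys q. ?s q v)"
    by (simp only: sum_product restrict_letters_sum single)
  then show ?thesis
    by (simp only: poly_mapping_eq_sum_single[symmetric])
qed

lemma keys_restrict_letters:
  "Poly_Mapping.keys (restrict_letters X p) = {w \<in> Poly_Mapping.keys p. set (letters w) \<subseteq> X}"
  by (auto simp: in_keys_iff lookup_restrict_letters)

lemma restrict_letters_closed: "restrict_letters X p \<in> carrier (free_algebra X)"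
  by (simp add: mem_free_algebra_iff keys_restrict_letters)

lemma restrict_letters_nonunital:
  "p \<in> nonunital_free_algebra Y \<Longrightarrow> restrict_letters X p \<in> nonunital_free_algebra X"
  by (simp add: mem_nonunital_free_algebra_iff restrict_letters_closed keys_restrict_letters)

lemma restrict_letters_ring_hom:
  "ring_hom_ring (free_algebra Y) (free_algebra X :: ('x word \<Rightarrow>\<^sub>0 'k::field) ring) (restrict_letters X)"
  by (rule ring_hom_ringI2[OF ring_free_algebra ring_free_algebra], rule ring_hom_memI)
    (simp_all add: restrict_letters_closed restrict_letters_add restrict_letters_mult restrict_letters_one)

lemma fin_digraph_quotient_graph:
  assumes "fin_digraph E" "hereditary E H"
  shows "fin_digraph (quotient_graph E H)"
proof -
  interpret fin_digraph E by fact
  show ?thesis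
    using assms(2) by unfold_locales (auto simp: quotient_graph_def hereditary_def out_arcs_def)
qed

lemma tail_in_quotient_graph:
  assumes "hereditary E H" "e \<in> arcs E" "head E e \<notin> H"
  shows "tail E e \<notin> H"
  using assms by (auto simp: hereditary_def out_arcs_def)

text \<open>This is where the two conditions on \<open>H\<close> enter. As \<open>H\<close> is hereditary, an edge that survives in the
  quotient graph also has its source there, and a vertex in \<open>H\<close> emits no surviving edge, so that the
  relator expressing it through its outgoing edges is sent to zero. As \<open>H\<close> is saturated, a regular
  vertex outside \<open>H\<close> emits at least one surviving edge; it is therefore still regular, and the
  truncation of that relator is the corresponding relator of the quotient graph.\<close>

lemma restrict_letters_relator:
  fixes E :: "('v, 'e) pre_digraph" and \<rho> :: "('v, 'e) generator word \<Rightarrow>\<^sub>0 'k::field"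
  assumes fin: "fin_digraph E" and H: "hereditary E H" "saturated E H"
    and \<rho>: "\<rho> \<in> leavitt_relators E"
  shows "restrict_letters (generators (quotient_graph E H)) \<rho> = 0 \<or>
    restrict_letters (generators (quotient_graph E H)) \<rho> \<in> leavitt_relators (quotient_graph E H)"
proof -
  interpret fin_digraph E by fact
  let ?Q = "quotient_graph E H"
  let ?r = "restrict_letters (generators ?Q) :: (_ \<Rightarrow>\<^sub>0 'k) \<Rightarrow> _"
  have Q: "verts ?Q = verts E - H" "arcs ?Q = {e \<in> arcs E. head E e \<notin> H}"
    "tail ?Q = tail E" "head ?Q = head E"
    by (simp_all add: quotient_graph_def)
  have r_vtx: "?r (vtx v) = (if v \<in> H then 0 else vtx v)" if "v \<in> verts E" for v
    using that by (auto simp: restrict_letters_monomial generators_def Q)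
  have r_edg: "?r (edg e) = (if head E e \<in> H then 0 else edg e)"
    and r_gho: "?r (gho e) = (if head E e \<in> H then 0 else gho e)" if "e \<in> arcs E" for e
    using that by (auto simp: restrict_letters_monomial generators_def Q)
  note tail = tail_in_quotient_graph[OF H(1)]
  note r = restrict_letters_diff restrict_letters_mult r_vtx r_edg r_gho
  consider
      (vv) v w where "\<rho> = vtx v * vtx w - (if v = w then vtx w else 0)" "v \<in> verts E" "w \<in> verts E"
    | (se) e where "\<rho> = vtx (tail E e) * edg e - edg e" "e \<in> arcs E"
    | (er) e where "\<rho> = edg e * vtx (head E e) - edg e" "e \<in> arcs E"
    | (rg) e where "\<rho> = vtx (head E e) * gho e - gho e" "e \<in> arcs E"
    | (gs) e where "\<rho> = gho e * vtx (tail E e) - gho e" "e \<in> arcs E"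
    | (ge) e f where "\<rho> = gho e * edg f - (if e = f then vtx (head E e) else 0)"
        "e \<in> arcs E" "f \<in> arcs E"
    | (ck) v where "\<rho> = vtx v - (\<Sum>e \<in> out_arcs E v. edg e * gho e)" "regular_vertex E v"
    using \<rho> unfolding leavitt_relators_def Un_iff mem_Collect_eq by (elim disjE exE conjE) (rule that; assumption)+
  then show ?thesis
  proof cases
    case vv
    show ?thesis
    proof (cases "v \<in> H \<or> w \<in> H")
      case True
      then have "?r \<rho> = 0" using vv by (auto simp: r)
      then show ?thesis ..
    next
      case False
      then have "?r \<rho> = vtx v * vtx w - (if v = w then vtx w else 0)" using vv by (auto simp: r)
      then have "?r \<rho> \<in> leavitt_relators ?Q"
        using vv False leavitt_relatorsI(1)[of v ?Q w] by (simp add: Q)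
      then show ?thesis ..
    qed
  next
    case se
    show ?thesis
    proof (cases "head E e \<in> H")
      case False
      then have "?r \<rho> = vtx (tail E e) * edg e - edg e" using se tail by (simp add: r)
      then have "?r \<rho> \<in> leavitt_relators ?Q"
        using se False leavitt_relatorsI(2)[of e ?Q] by (simp add: Q)
      then show ?thesis ..
    qed (use se in \<open>simp add: r\<close>)
  next
    case er
    show ?thesis
    proof (cases "head E e \<in> H")
      case False
      then have "?r \<rho> = edg e * vtx (head E e) - edg e" using er by (simp add: r)
      then have "?r \<rho> \<in> leavitt_relators ?Q"
        using er False leavitt_relatorsI(3)[of e ?Q] by (simp add: Q)
      then show ?thesis ..
    qed (use er in \<open>simp add: r\<close>)
  next
    case rg
    show ?thesis
    proof (cases "head E e \<in> H")
      case False
      then have "?r \<rho> = vtx (head E e) * gho e - gho e" using rg by (simp add: r)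
      then have "?r \<rho> \<in> leavitt_relators ?Q"
        using rg False leavitt_relatorsI(4)[of e ?Q] by (simp add: Q)
      then show ?thesis ..
    qed (use rg in \<open>simp add: r\<close>)
  next
    case gs
    show ?thesis
    proof (cases "head E e \<in> H")
      case False
      then have "?r \<rho> = gho e * vtx (tail E e) - gho e" using gs tail by (simp add: r)
      then have "?r \<rho> \<in> leavitt_relators ?Q"
        using gs False leavitt_relatorsI(5)[of e ?Q] by (simp add: Q)
      then show ?thesis ..
    qed (use gs in \<open>simp add: r\<close>)
  next
    case ge
    show ?thesis
    proof (cases "head E e \<in> H \<or> head E f \<in> H")
      case True
      then have "?r \<rho> = 0" using ge by (auto simp: r)
      then show ?thesis ..
    next
      case False
      then have "?r \<rho> = gho e * edg f - (if e = f then vtx (head E e) else 0)"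
        using ge by (auto simp: r)
      then have "?r \<rho> \<in> leavitt_relators ?Q"
        using ge False leavitt_relatorsI(6)[of e ?Q f]
          by (cases "e = f") (simp_all add: Q)
      then show ?thesis ..
    qed
  next
    case ck
    have v: "v \<in> verts E" and fin_out: "finite (out_arcs E v)" and arcs: "out_arcs E v \<subseteq> arcs E"
      using ck by (auto simp: regular_vertex_def out_arcs_def)
    have outQ: "out_arcs ?Q v = {e \<in> out_arcs E v. head E e \<notin> H}"
      by (auto simp: out_arcs_def Q)
    have "?r \<rho> = ?r (vtx v) - (\<Sum>e\<in>out_arcs E v. if head E e \<notin> H then edg e * gho e else 0)"
      unfolding ck(1) restrict_letters_diff restrict_letters_sum
      using arcs by (intro arg_cong2[where f = "(-)"] refl sum.cong) (auto simp: r)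
    also have "\<dots> = ?r (vtx v) - (\<Sum>e\<in>out_arcs ?Q v. edg e * gho e)"
      unfolding outQ by (simp only: sum.inter_filter[OF fin_out])
    finally have r\<rho>: "?r \<rho> = ?r (vtx v) - (\<Sum>e\<in>out_arcs ?Q v. edg e * gho e)" .
    show ?thesis
    proof (cases "v \<in> H")
      case True
      then have "out_arcs ?Q v = {}"
        using H(1) by (auto simp: outQ hereditary_def)
      then have "?r \<rho> = 0"
        using True v r\<rho> by (simp add: r_vtx)
      then show ?thesis ..
    next
      case False
      then have "\<not> head E ` out_arcs E v \<subseteq> H"
        using H(2) ck(2) unfolding saturated_def by blast
      then have "regular_vertex ?Q v"
        using False ck(2) by (auto simp: regular_vertex_def outQ Q)
      then have "?r \<rho> \<in> leavitt_relators ?Q"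
        using False v r\<rho> leavitt_relatorsI(7)[of ?Q v] by (simp add: r_vtx)
      then show ?thesis ..
    qed
  qed
qed

text \<open>The preimage of an ideal is an ideal, and it contains the relators by the previous lemma.\<close>

lemma restrict_letters_leavitt_ideal:
  fixes E :: "('v, 'e) pre_digraph" and p :: "('v, 'e) generator word \<Rightarrow>\<^sub>0 'k::field"
  assumes fin: "fin_digraph E" and H: "hereditary E H" "saturated E H"
    and p: "p \<in> leavitt_ideal E"
  shows "restrict_letters (generators (quotient_graph E H)) p \<in> leavitt_ideal (quotient_graph E H)"
proof -
  interpret E: fin_digraph E by fact
  interpret Q: fin_digraph "quotient_graph E H"
    using fin H(1) by (rule fin_digraph_quotient_graph)
  let ?r = "restrict_letters (generators (quotient_graph E H)) :: (_ \<Rightarrow>\<^sub>0 'k) \<Rightarrow> _"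
  let ?F = "free_algebra (generators E) :: (('v, 'e) generator word \<Rightarrow>\<^sub>0 'k) ring"
  let ?J = "{p \<in> carrier ?F. ?r p \<in> leavitt_ideal (quotient_graph E H)}"
  have "ideal ?J ?F"
    by (rule ring_hom_ring.ideal_vimage[OF restrict_letters_ring_hom Q.ideal_leavitt_ideal])
  moreover have "leavitt_relators E \<subseteq> ?J"
  proof
    fix \<rho> :: "('v, 'e) generator word \<Rightarrow>\<^sub>0 'k" assume \<rho>: "\<rho> \<in> leavitt_relators E"
    have "?r \<rho> \<in> leavitt_ideal (quotient_graph E H)"
      using restrict_letters_relator[OF fin H \<rho>]
    proof
      assume "?r \<rho> = 0"
      then show ?thesis by (simp only: Q.zero_in_leavitt_ideal)
    qed (rule subsetD[OF Q.leavitt_relators_subset])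
    then show "\<rho> \<in> ?J"
      using subsetD[OF E.leavitt_relators_closed \<rho>] by simp
  qed
  ultimately have "leavitt_ideal E \<subseteq> ?J"
    unfolding leavitt_ideal_def[of E] by (rule ring.genideal_minimal[OF ring_free_algebra])
  then show ?thesis using p by blast
qed

text \<open>The map induced on cosets, described by the common value of the representatives: the image of a
  coset is a singleton as soon as the truncation respects the two ideals.\<close>

definition leavitt_quotient_map ::
    "('v, 'e) pre_digraph \<Rightarrow> 'v set \<Rightarrow> (('v, 'e) generator word \<Rightarrow>\<^sub>0 'k::field) set
       \<Rightarrow> (('v, 'e) generator word \<Rightarrow>\<^sub>0 'k) set" where
  "leavitt_quotient_map E H C =
     the_elem ((\<lambda>p. leavitt_class (quotient_graph E H)
       (restrict_letters (generators (quotient_graph E H)) p)) ` C)"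

lemma leavitt_quotient_map_class:
  fixes E :: "('v, 'e) pre_digraph" and p :: "('v, 'e) generator word \<Rightarrow>\<^sub>0 'k::field"
  assumes fin: "fin_digraph E" and H: "hereditary E H" "saturated E H"
    and p: "p \<in> carrier (free_algebra (generators E))"
  shows "leavitt_quotient_map E H (leavitt_class E p) =
    leavitt_class (quotient_graph E H) (restrict_letters (generators (quotient_graph E H)) p)"
proof -
  interpret E: fin_digraph E by fact
  interpret Q: fin_digraph "quotient_graph E H"
    using fin H(1) by (rule fin_digraph_quotient_graph)
  let ?r = "restrict_letters (generators (quotient_graph E H)) :: (_ \<Rightarrow>\<^sub>0 'k) \<Rightarrow> _"
  let ?f = "\<lambda>p. leavitt_class (quotient_graph E H) (?r p)"
  have class_p: "leavitt_class E p = {i + p | i. i \<in> leavitt_ideal E}"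
    by (auto simp: leavitt_class_def a_r_coset_def')
  have "?f q = ?f p" if q: "q \<in> leavitt_class E p" for q
  proof -
    obtain i where i: "i \<in> leavitt_ideal E" "q = i + p"
      using q class_p by blast
    have "?r q - ?r p \<in> leavitt_ideal (quotient_graph E H)"
      using restrict_letters_leavitt_ideal[OF fin H i(1)] i(2) by (simp add: restrict_letters_add)
    then show ?thesis
      by (simp add: Q.leavitt_class_eq_iff restrict_letters_closed)
  qed
  moreover have "p \<in> leavitt_class E p"
    unfolding class_p by (intro CollectI exI[of _ 0]) (simp add: E.zero_in_leavitt_ideal)
  ultimately have "?f ` leavitt_class E p = {?f p}"
    by blast
  then show ?thesis
    by (simp add: leavitt_quotient_map_def)
qed

theorem leavitt_quotient_map_graded_hom:
  fixes E :: "('v, 'e) pre_digraph" and H :: "'v set"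
  assumes fin: "fin_digraph E" and H: "hereditary E H" "saturated E H"
  defines "L \<equiv> leavitt_path_algebra TYPE('k::field) E"
    and "M \<equiv> leavitt_path_algebra TYPE('k) (quotient_graph E H)"
  shows "leavitt_quotient_map E H \<in> ring_hom L M"
    and "a \<in> component L n \<Longrightarrow> leavitt_quotient_map E H a \<in> component M n"
proof -
  interpret E: fin_digraph E by fact
  interpret Q: fin_digraph "quotient_graph E H"
    using fin H(1) by (rule fin_digraph_quotient_graph)
  let ?h = "leavitt_quotient_map E H :: (_ \<Rightarrow>\<^sub>0 'k) set \<Rightarrow> _"
  let ?r = "restrict_letters (generators (quotient_graph E H)) :: (_ \<Rightarrow>\<^sub>0 'k) \<Rightarrow> _"
  let ?A = "nonunital_free_algebra (generators E) :: (_ \<Rightarrow>\<^sub>0 'k) set"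
  have AF: "p \<in> carrier (free_algebra (generators E))" if "p \<in> ?A" for p
    using that by (simp add: mem_nonunital_free_algebra_iff)
  have h: "?h (leavitt_class E p) = leavitt_class (quotient_graph E H) (?r p)" if "p \<in> ?A" for p
    using leavitt_quotient_map_class[OF fin H AF[OF that]] .
  have carrier_L: "carrier L = leavitt_class E ` ?A"
    unfolding L_def by (rule E.leavitt_path_algebra_simps)
  show "?h \<in> ring_hom L M"
  proof (rule ring_hom_memI)
    fix x assume "x \<in> carrier L"
    then show "?h x \<in> carrier M"
      unfolding M_def Q.leavitt_path_algebra_simps carrier_L
      using h restrict_letters_nonunital by blast
  next
    fix x y assume "x \<in> carrier L" "y \<in> carrier L"
    then obtain p q where p: "p \<in> ?A" "x = leavitt_class E p" and q: "q \<in> ?A" "y = leavitt_class E q"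
      unfolding carrier_L by blast
    show "?h (x \<otimes>\<^bsub>L\<^esub> y) = ?h x \<otimes>\<^bsub>M\<^esub> ?h y"
      using p q nonunital_free_algebra_closed(3)[OF p(1) q(1)]
      by (simp add: L_def M_def E.leavitt_class_mult Q.leavitt_class_mult AF h
          restrict_letters_closed restrict_letters_mult)
    show "?h (x \<oplus>\<^bsub>L\<^esub> y) = ?h x \<oplus>\<^bsub>M\<^esub> ?h y"
      using p q nonunital_free_algebra_closed(1)[OF p(1) q(1)]
      by (simp add: L_def M_def E.leavitt_class_add Q.leavitt_class_add AF h
          restrict_letters_closed restrict_letters_add)
  next
    have "?r (vertex_sum E) = (\<Sum>v\<in>verts E. if v \<in> verts E - H then vtx v else 0)"
      unfolding restrict_letters_sum restrict_letters_monomial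
      by (intro sum.cong) (auto simp: generators_def quotient_graph_def)
    also have "\<dots> = (\<Sum>v\<in>{v\<in>verts E. v \<in> verts E - H}. vtx v)"
      by (simp only: sum.inter_filter[OF E.finite_verts])
    also have "{v\<in>verts E. v \<in> verts E - H} = verts (quotient_graph E H)"
      by (auto simp: quotient_graph_def)
    finally show "?h \<one>\<^bsub>L\<^esub> = \<one>\<^bsub>M\<^esub>"
      unfolding L_def M_def E.leavitt_path_algebra_simps Q.leavitt_path_algebra_simps
      using h[OF E.vertex_sum_in_nonunital] by simp
  qed
  show "?h a \<in> component M n" if a: "a \<in> component L n"
  proof -
    obtain p where p: "p \<in> ?A" "\<forall>w \<in> Poly_Mapping.keys p. word_degree w = n" "a = leavitt_class E p"
      using a unfolding L_def E.leavitt_path_algebra_simps by blast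
    then show ?thesis
      unfolding M_def Q.leavitt_path_algebra_simps
      using h[OF p(1)] restrict_letters_nonunital[OF p(1)] by (auto simp: keys_restrict_letters)
  qed
qed

section \<open>Graded invariant basis number and quotient graphs\<close>

theorem proposition4p7:
  fixes E :: "('v, 'e) pre_digraph" and H :: "'v set"
  assumes "fin_digraph E"
    and "hereditary E H" and "saturated E H"
    and "gr_IBN (leavitt_path_algebra TYPE('k::field) (quotient_graph E H))"
  shows "gr_IBN (leavitt_path_algebra TYPE('k) E)"
proof (rule gr_IBN_of_graded_hom)
  show "weakly_graded_ring (leavitt_path_algebra TYPE('k) E)"
    using assms(1) by (rule fin_digraph.weakly_graded_ring_leavitt_path_algebra)
  show "weakly_graded_ring (leavitt_path_algebra TYPE('k) (quotient_graph E H))"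
    using fin_digraph_quotient_graph[OF assms(1,2)] by (rule fin_digraph.weakly_graded_ring_leavitt_path_algebra)
  show "leavitt_quotient_map E H \<in> ring_hom (leavitt_path_algebra TYPE('k) E)
      (leavitt_path_algebra TYPE('k) (quotient_graph E H))"
    by (rule leavitt_quotient_map_graded_hom[OF assms(1-3)])
  show "leavitt_quotient_map E H a \<in> component (leavitt_path_algebra TYPE('k) (quotient_graph E H)) \<gamma>"
    if "a \<in> component (leavitt_path_algebra TYPE('k) E) \<gamma>" for a \<gamma>
    using leavitt_quotient_map_graded_hom(2)[OF assms(1-3) that] .
qed (rule assms(4))

end
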